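(* Let $X$ be a complex Banach space and let $T\in\mathcal{B}(X)$. Suppose that $T$ satisfies at least one of the following conditions: (1) $\sigma(T)=\sigma_{su}(T)$; (2) $\operatorname{int}(\sigma_{ap}(T))=\emptyset$; (3) $\operatorname{int}(\sigma_{p}(T))=\emptyset$; (4) $\operatorname{int}(\sigma_{asc}(T))=\emptyset$; (5) $\operatorname{int}(\sigma_{ub}(T))=\emptyset$; (6) $\operatorname{int}(\sigma_{uw}(T))=\emptyset$; (7) $\mathcal{S}(T)=\emptyset$. Then $$\sigma_{desc}(T)=\sigma_{desc}(T,\mathcal{B}(X)).$$
   Context: $\mathcal{B}(X)$ is the Banach algebra of all bounded linear operators on $X$; $\operatorname{int}$ denotes the interior in $\mathbb{C}$; $N(S)$ and $R(S)$ denote the kernel and range of an operator $S$. For $T\in\mathcal{B}(X)$: $\sigma(T)$ is the spectrum; $\sigma_{su}(T)=\{\lambda\in\mathbb{C}: \lambda-T\text{ is not surjective}\}$; $\sigma_p(T)=\{\lambda\in\mathbb{C}: \lambda-T\text{ is not injective}\}$; $\sigma_{ap}(T)=\{\lambda\in\mathbb{C}: \lambda-T\text{ is not bounded below}\}$ is the approximate point spectrum. The ascent of an operator $S$ is $a(S)=\min\{p\ge 0: N(S^p)=N(S^{p+1})\}$ and the descent is $d(S)=\min\{q\ge 0: R(S^q)=R(S^{q+1})\}$, each being $\infty$ if no such integer exists. $\sigma_{asc}(T)=\{\lambda\in\mathbb{C}: a(\lambda-T)=\infty\}$ and $\sigma_{desc}(T)=\{\lambda\in\mathbb{C}: d(\lambda-T)=\infty\}$.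 The descent spectrum of $T$ as an element of the algebra $\mathcal{B}(X)$ is $\sigma_{desc}(T,\mathcal{B}(X))=\{\lambda\in\mathbb{C}: d(L_{T-\lambda})=\infty\}$, where for $A\in\mathcal{B}(X)$ the operator $L_A:\mathcal{B}(X)\to\mathcal{B}(X)$ is left multiplication, $L_A(S)=AS$. Let $\alpha(S)=\dim N(S)$ and $\beta(S)=\operatorname{codim}R(S)$. $S\in\mathcal{B}(X)$ is upper semi-Fredholm ($S\in\Phi_+(X)$) if $\alpha(S)<\infty$ and $R(S)$ is closed; in this case $\operatorname{ind}(S)=\alpha(S)-\beta(S)\in\mathbb{Z}\cup\{-\infty\}$. Put $B_+(X)=\{S\in\Phi_+(X): a(S)<\infty\}$ and $W_+(X)=\{S\in\Phi_+(X): \operatorname{ind}(S)\le 0\}$. The upper semi-Browder spectrum is $\sigma_{ub}(T)=\{\lambda\in\mathbb{C}:\lambda I-T\notin B_+(X)\}$ and the upper semi-Weyl spectrum is $\sigma_{uw}(T)=\{\lambda\in\mathbb{C}:\lambda I-T\notin W_+(X)\}$. $T$ has the single-valued extension property (SVEP) at $\lambda_0\in\mathbb{C}$ if for every open neighbourhood $\mathcal{U}$ of $\lambda_0$ the only analytic function $f:\mathcal{U}\to X$ satisfying $(\lambda I-T)f(\lambda)=0$ for all $\lambda\in\mathcal{U}$ is $f\equiv 0$. $\mathcal{S}(T)$ is the set of $\lambda\in\mathbb{C}$ at which $T$ does not have the SVEP. *)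

theory Defs
  imports "HOL-Analysis.Analysis"
begin

class complex_normed_vector = real_normed_vector +
  fixes scaleC :: "complex \<Rightarrow> 'a \<Rightarrow> 'a"  (infixr "*\<^sub>C" 75)
  assumes scaleC_add_right: "a *\<^sub>C (x + y) = a *\<^sub>C x + a *\<^sub>C y"
    and scaleC_add_left: "(a + b) *\<^sub>C x = a *\<^sub>C x + b *\<^sub>C x"
    and scaleC_scaleC: "a *\<^sub>C b *\<^sub>C x = (a * b) *\<^sub>C x"
    and scaleR_scaleC: "r *\<^sub>R x = complex_of_real r *\<^sub>C x"
    and norm_scaleC: "norm (a *\<^sub>C x) = cmod a * norm x"

class complex_banach = complex_normed_vector + banach

instantiation complex :: complex_banach
begin

definition scaleC_complex :: "complex \<Rightarrow> complex \<Rightarrow> complex"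
  where "scaleC_complex a x = a * x"

instance
  by standard
    (auto simp: scaleC_complex_def algebra_simps norm_mult scaleR_conv_of_real)

end

lemma scaleC_one: "1 *\<^sub>C x = (x :: 'a::complex_normed_vector)"
  using scaleR_scaleC[of 1 x] by simp

global_interpretation complex_vector:
  vector_space "scaleC :: complex \<Rightarrow> 'a \<Rightarrow> 'a::complex_normed_vector"
  by standard (simp_all add: scaleC_add_right scaleC_add_left scaleC_scaleC scaleC_one)

definition bounded_clinear :: "('a::complex_normed_vector \<Rightarrow> 'b::complex_normed_vector) \<Rightarrow> bool"
  where "bounded_clinear S \<longleftrightarrow> bounded_linear S \<and> (\<forall>c x. S (c *\<^sub>C x) = c *\<^sub>C S x)"

definition bounded_ops :: "('a::complex_normed_vector \<Rightarrow> 'a) set"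
  where "bounded_ops = {S. bounded_clinear S}"

definition scalar_minus :: "complex \<Rightarrow> ('a::complex_normed_vector \<Rightarrow> 'a) \<Rightarrow> 'a \<Rightarrow> 'a"
  where "scalar_minus c T = (\<lambda>x. c *\<^sub>C x - T x)"

definition minus_scalar :: "('a::complex_normed_vector \<Rightarrow> 'a) \<Rightarrow> complex \<Rightarrow> 'a \<Rightarrow> 'a"
  where "minus_scalar T c = (\<lambda>x. T x - c *\<^sub>C x)"

definition op_kernel :: "('a \<Rightarrow> 'a::zero) \<Rightarrow> 'a set"
  where "op_kernel S = {x. S x = 0}"

definition bounded_below :: "('a::complex_normed_vector \<Rightarrow> 'a) \<Rightarrow> bool"
  where "bounded_below S \<longleftrightarrow> (\<exists>c>0. \<forall>x. c * norm x \<le> norm (S x))"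

definition invertible_op :: "('a::complex_normed_vector \<Rightarrow> 'a) \<Rightarrow> bool"
  where "invertible_op S \<longleftrightarrow> (\<exists>R\<in>bounded_ops. R \<circ> S = id \<and> S \<circ> R = id)"

text \<open>In \<^typ>\<open>enat\<close> the infimum of the empty set is \<^term>\<open>\<infinity>\<close>.\<close>

definition ascent :: "('a \<Rightarrow> 'a::zero) \<Rightarrow> enat"
  where "ascent S = (INF p\<in>{p. op_kernel (S ^^ p) = op_kernel (S ^^ Suc p)}. enat p)"

text \<open>The carrier \<open>V\<close> is explicit because \<^const>\<open>bounded_ops\<close>, on which left
  multiplications act, is not a type.\<close>

definition descent_on :: "'v set \<Rightarrow> ('v \<Rightarrow> 'v) \<Rightarrow> enat"
  where "descent_on V F = (INF q\<in>{q. (F ^^ q) ` V = (F ^^ Suc q) ` V}. enat q)"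

abbreviation descent :: "('a \<Rightarrow> 'a) \<Rightarrow> enat"
  where "descent S \<equiv> descent_on UNIV S"

definition left_mult :: "('a \<Rightarrow> 'a) \<Rightarrow> ('a \<Rightarrow> 'a) \<Rightarrow> ('a \<Rightarrow> 'a)"
  where "left_mult A = (\<lambda>S. A \<circ> S)"

definition cdim :: "'a::complex_normed_vector set \<Rightarrow> enat"
  where "cdim M = (if \<exists>B. finite B \<and> M \<subseteq> complex_vector.span B
                   then enat (complex_vector.dim M) else \<infinity>)"

text \<open>\<open>B\<close> is a set of representatives, one for each member, of a basis of the
  quotient by the subspace \<open>M\<close>.\<close>

definition quotient_basis :: "'a::complex_normed_vector set \<Rightarrow> 'a set \<Rightarrow> bool"
  where "quotient_basis M B \<longleftrightarrow>
    complex_vector.independent B \<and>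
    complex_vector.span B \<inter> M = {0} \<and>
    complex_vector.span (B \<union> M) = UNIV"

definition ccodim :: "'a::complex_normed_vector set \<Rightarrow> enat"
  where "ccodim M = (if \<exists>B. finite B \<and> quotient_basis M B
                     then enat (card (SOME B. finite B \<and> quotient_basis M B)) else \<infinity>)"

text \<open>Any two finite bases of the quotient have the same size, so the choice in
  \<^const>\<open>ccodim\<close> is immaterial.\<close>

lemma quotient_basis_card_le:
  assumes M: "complex_vector.subspace M"
    and B: "quotient_basis M B" and C: "quotient_basis M C" "finite C"
  shows "card B \<le> card C"
proof -
  interpret vp: vector_space_pair "scaleC :: complex \<Rightarrow> 'a \<Rightarrow> 'a" "scaleC :: complex \<Rightarrow> 'a \<Rightarrow> 'a"
    by unfold_locales
  have indB: "complex_vector.independent B" and trivB: "complex_vector.span B \<inter> M = {0}"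
    using B by (auto simp: quotient_basis_def)
  have "\<exists>y. y \<in> complex_vector.span C \<and> b - y \<in> M" for b
  proof -
    have "b \<in> complex_vector.span (C \<union> M)"
      using C(1) by (simp add: quotient_basis_def)
    then obtain y m where "b = y + m" "y \<in> complex_vector.span C" "m \<in> complex_vector.span M"
      unfolding complex_vector.span_Un by blast
    moreover have "complex_vector.span M = M"
      using M by (simp add: complex_vector.span_eq_iff)
    ultimately show ?thesis by auto
  qed
  then obtain p where p: "\<And>b. p b \<in> complex_vector.span C" "\<And>b. b - p b \<in> M"
    by metis
  define f where "f = vp.construct B p"
  have lin: "Vector_Spaces.linear scaleC scaleC f"
    unfolding f_def by (rule vp.linear_construct[OF indB])
  have fB: "f b = p b" if "b \<in> B" for b
    unfolding f_def by (rule vp.construct_basis[OF indB that])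
  have diff: "x - f x \<in> M" if "x \<in> complex_vector.span B" for x
    using that
  proof (induction rule: complex_vector.span_induct_alt)
    case base
    then show ?case
      using complex_vector.subspace_0[OF M] vp.linear_0[OF lin] by simp
  next
    case (step c b y)
    have "c *\<^sub>C b + y - f (c *\<^sub>C b + y) = c *\<^sub>C (b - p b) + (y - f y)"
      using fB[OF step(1)]
      by (simp add: vp.linear_add[OF lin] vp.linear_scale[OF lin]
          complex_vector.scale_right_diff_distrib)
    moreover have "c *\<^sub>C (b - p b) + (y - f y) \<in> M"
      using M p(2) step(2)
      by (intro complex_vector.subspace_add complex_vector.subspace_scale)
    ultimately show ?case by (simp only:)
  qed
  have inj: "inj_on f (complex_vector.span B)"
    unfolding vp.linear_inj_on_iff_eq_0[OF lin complex_vector.subspace_span]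
    using diff trivB by fastforce
  have "complex_vector.independent (f ` B)"
    using vp.linear_independent_injective_image[OF lin indB inj] .
  moreover have "f ` B \<subseteq> complex_vector.span C"
    using fB p(1) by auto
  ultimately have "card (f ` B) \<le> card C"
    using complex_vector.independent_span_bound[OF C(2)] by blast
  moreover have "card (f ` B) = card B"
    by (rule card_image) (meson inj complex_vector.span_superset inj_on_subset)
  ultimately show ?thesis by simp
qed

lemma ccodim_eq_card:
  assumes "complex_vector.subspace M" "quotient_basis M B" "finite B"
  shows "ccodim M = enat (card B)"
proof -
  have "finite (SOME B. finite B \<and> quotient_basis M B) \<and>
        quotient_basis M (SOME B. finite B \<and> quotient_basis M B)"
    by (rule someI[where x = B]) (use assms in simp)
  then have "card (SOME B. finite B \<and> quotient_basis M B) = card B"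
    using assms by (meson quotient_basis_card_le le_antisym)
  then show ?thesis
    using assms by (auto simp: ccodim_def)
qed

definition nullity :: "('a::complex_normed_vector \<Rightarrow> 'a) \<Rightarrow> enat"
  where "nullity S = cdim (op_kernel S)"

definition defect :: "('a::complex_normed_vector \<Rightarrow> 'a) \<Rightarrow> enat"
  where "defect S = ccodim (range S)"

definition upper_semi_fredholm :: "('a::complex_normed_vector \<Rightarrow> 'a) set"
  where "upper_semi_fredholm = {S \<in> bounded_ops. nullity S < \<infinity> \<and> closed (range S)}"

text \<open>On \<^typ>\<open>ereal\<close>, \<^term>\<open>\<infinity> - \<infinity>\<close> is \<^term>\<open>\<infinity>\<close>; the index is used only for finite nullity.\<close>

definition fredholm_index :: "('a::complex_normed_vector \<Rightarrow> 'a) \<Rightarrow> ereal"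
  where "fredholm_index S = ereal_of_enat (nullity S) - ereal_of_enat (defect S)"

definition upper_semi_browder :: "('a::complex_normed_vector \<Rightarrow> 'a) set"
  where "upper_semi_browder = {S \<in> upper_semi_fredholm. ascent S < \<infinity>}"

definition upper_semi_weyl :: "('a::complex_normed_vector \<Rightarrow> 'a) set"
  where "upper_semi_weyl = {S \<in> upper_semi_fredholm. fredholm_index S \<le> 0}"

definition op_spectrum :: "('a::complex_normed_vector \<Rightarrow> 'a) \<Rightarrow> complex set"
  where "op_spectrum T = {c. \<not> invertible_op (scalar_minus c T)}"

definition surjectivity_spectrum :: "('a::complex_normed_vector \<Rightarrow> 'a) \<Rightarrow> complex set"
  where "surjectivity_spectrum T = {c. \<not> surj (scalar_minus c T)}"

definition point_spectrum :: "('a::complex_normed_vector \<Rightarrow> 'a) \<Rightarrow> complex set"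
  where "point_spectrum T = {c. \<not> inj (scalar_minus c T)}"

definition approx_point_spectrum :: "('a::complex_normed_vector \<Rightarrow> 'a) \<Rightarrow> complex set"
  where "approx_point_spectrum T = {c. \<not> bounded_below (scalar_minus c T)}"

definition ascent_spectrum :: "('a::complex_normed_vector \<Rightarrow> 'a) \<Rightarrow> complex set"
  where "ascent_spectrum T = {c. ascent (scalar_minus c T) = \<infinity>}"

definition descent_spectrum :: "('a::complex_normed_vector \<Rightarrow> 'a) \<Rightarrow> complex set"
  where "descent_spectrum T = {c. descent (scalar_minus c T) = \<infinity>}"

definition algebra_descent_spectrum :: "('a::complex_normed_vector \<Rightarrow> 'a) \<Rightarrow> complex set"
  where "algebra_descent_spectrum T =
    {c. descent_on bounded_ops (left_mult (minus_scalar T c)) = \<infinity>}"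

definition upper_browder_spectrum :: "('a::complex_normed_vector \<Rightarrow> 'a) \<Rightarrow> complex set"
  where "upper_browder_spectrum T = {c. scalar_minus c T \<notin> upper_semi_browder}"

definition upper_weyl_spectrum :: "('a::complex_normed_vector \<Rightarrow> 'a) \<Rightarrow> complex set"
  where "upper_weyl_spectrum T = {c. scalar_minus c T \<notin> upper_semi_weyl}"

text \<open>On open sets, analyticity of a vector-valued function is complex differentiability;
  the library's \<^const>\<open>analytic_on\<close> covers only complex-valued functions.\<close>

definition vec_holomorphic_on :: "(complex \<Rightarrow> 'a::complex_normed_vector) \<Rightarrow> complex set \<Rightarrow> bool"
  where "vec_holomorphic_on f U \<longleftrightarrow>
    (\<forall>z\<in>U. \<exists>D. (f has_derivative (\<lambda>h. h *\<^sub>C D)) (at z within U))"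

definition svep_at :: "('a::complex_normed_vector \<Rightarrow> 'a) \<Rightarrow> complex \<Rightarrow> bool"
  where "svep_at T c \<longleftrightarrow>
    (\<forall>U f. open U \<and> c \<in> U \<and> vec_holomorphic_on f U \<and> (\<forall>z\<in>U. scalar_minus z T (f z) = 0)
       \<longrightarrow> (\<forall>z\<in>U. f z = 0))"

definition non_svep_set :: "('a::complex_normed_vector \<Rightarrow> 'a) \<Rightarrow> complex set"
  where "non_svep_set T = {c. \<not> svep_at T c}"

end

theory Submission
  imports Defs
begin

text \<open>
  Put \<open>A = T - c\<close> and suppose \<open>R(A\<^sup>q) = R(A\<^sup>q\<^sup>+\<^sup>1)\<close>. A Baire argument gives backward orbits
  \<open>A y\<^bsub>n+1\<^esub> = y\<^bsub>n\<^esub>\<close> of geometric growth starting at any point of \<open>R(A\<^sup>q)\<close>, and the power series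
  \<open>\<Sum> m\<^sup>n y\<^bsub>n\<^esub>\<close> then shows two things: \<open>A - m\<close> is surjective for all small \<open>m \<noteq> 0\<close>, and a nonzero
  \<open>y\<^bsub>0\<^esub> \<in> N(A) \<inter> R(A\<^sup>q)\<close> extends to a holomorphic family of eigenvectors around \<open>c\<close>. Such
  a family contradicts condition (7), and near \<open>c\<close> it would make surjective operators
  non-injective, which each of the conditions (1)--(6) excludes. Hence \<open>A\<close> is injective on \<open>R(A\<^sup>q)\<close>, so that \<open>A\<^sup>q\<^sup>+\<^sup>1\<close> is a bijection of
  \<open>R(A\<^sup>q)\<close>; its inverse composed with \<open>A\<^sup>q\<close> is a bounded \<open>S\<close> with \<open>A\<^sup>q = A\<^sup>q\<^sup>+\<^sup>1 S\<close>, which says that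
  left multiplication by \<open>A\<close> has descent at most \<open>q\<close>.
\<close>

section \<open>Bounded lifts by the Baire category theorem\<close>

text \<open>The case \<open>V = id\<close> is the open mapping theorem.\<close>

lemma range_le_imp_norm_bounded_lift:
  fixes U :: "'a::banach \<Rightarrow> 'c::real_normed_vector" and V :: "'b::banach \<Rightarrow> 'c"
  assumes U: "bounded_linear U" and V: "bounded_linear V" and sub: "range V \<subseteq> range U"
  obtains C where "C > 0" "\<And>x. \<exists>z. U z = V x \<and> norm z \<le> C * norm x"
proof -
  interpret U: bounded_linear U by fact
  interpret V: bounded_linear V by fact
  \<comment> \<open>By \<open>sub\<close> these sets exhaust the space, so the closure of some
    \<open>E n\<close> contains a ball.\<close>
  define E where "E n = {x. \<exists>z. norm z \<le> real n \<and> U z = V x}" for n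
  have "\<exists>n. x \<in> E n" for x
    using sub unfolding E_def by (auto simp: subset_iff) (metis rangeE rangeI real_arch_simple)
  then have cov: "(\<Union>n. closure (E n)) = UNIV"
    using closure_subset by blast
  have "\<exists>n. interior (closure (E n)) \<noteq> {}"
  proof (rule ccontr)
    assume "\<not> ?thesis"
    then have "euclidean interior_of \<Union>(range (\<lambda>n. closure (E n))) = {}"
      by (intro Baire_category_alt) (auto simp: completely_metrizable_space_euclidean)
    with cov show False by simp
  qed
  then obtain n a r where r: "r > 0" and ball: "ball a r \<subseteq> closure (E n)"
    by (metis all_not_in_conv mem_interior)
  \<comment> \<open>One factor 2 comes from subtracting two points of \<open>E n\<close>, another
    from rescaling to norm \<open>r / 2\<close>; \<open>+ 1\<close> keeps \<open>K\<close> positive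
    when \<open>n = 0\<close>.\<close>
  define K where "K = 4 * real n / r + 1"
  have K: "K > 0" using r by (simp add: K_def add_nonneg_pos)
  \<comment> \<open>Subtracting approximants of \<open>a + x\<close> and of \<open>a\<close> moves
    the ball to the origin.\<close>
  have small: "\<exists>x' z. U z = V x' \<and> norm z \<le> 2 * real n \<and> norm (x - x') \<le> e"
    if x: "norm x < r" and e: "e > 0" for x e
  proof -
    have "a + x \<in> closure (E n)" "a \<in> closure (E n)"
      using ball r x by (auto simp: subset_iff dist_norm)
    then obtain x1 x2 where x12: "x1 \<in> E n" "dist x1 (a + x) < e/2" "x2 \<in> E n" "dist x2 a < e/2"
      using e by (metis closure_approachable half_gt_zero)
    then obtain z1 z2 where z: "norm z1 \<le> real n" "U z1 = V x1" "norm z2 \<le> real n" "U z2 = V x2"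
      by (auto simp: E_def)
    have "x - (x1 - x2) = (x2 - a) - (x1 - (a + x))" by simp
    then have "norm (x - (x1 - x2)) \<le> norm (x2 - a) + norm (x1 - (a + x))"
      by (metis norm_triangle_ineq4)
    moreover have "norm (z1 - z2) \<le> 2 * real n"
      using norm_triangle_ineq4[of z1 z2] z by linarith
    ultimately show ?thesis
      using x12 z by (intro exI[of _ "x1 - x2"] exI[of _ "z1 - z2"])
        (auto simp: dist_norm U.diff V.diff)
  qed
  have "\<exists>x' z. U z = V x' \<and> norm z \<le> K * norm x \<and> norm (x - x') \<le> norm x / 2" for x
  proof (cases "x = 0")
    case True
    then show ?thesis by (intro exI[of _ 0]) (simp add: U.zero V.zero)
  next
    case False
    define t where "t = r / (2 * norm x)"
    have t: "t > 0" using False r by (simp add: t_def)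
    have tx: "norm (t *\<^sub>R x) < r" using False r by (simp add: t_def)
    obtain x' z where z: "U z = V x'" "norm z \<le> 2 * real n" "norm (t *\<^sub>R x - x') \<le> t * (norm x / 2)"
      using small[OF tx, of "t * (norm x / 2)"] t False by auto
    have "U (z /\<^sub>R t) = V (x' /\<^sub>R t)"
      using z(1) by (simp add: U.scaleR V.scaleR)
    moreover have "norm (z /\<^sub>R t) \<le> K * norm x"
    proof -
      have "norm (z /\<^sub>R t) \<le> 2 * real n / t"
        using z(2) t by (simp add: divide_right_mono field_simps)
      also have "\<dots> = (4 * real n / r) * norm x"
        by (simp add: t_def)
      also have "\<dots> \<le> K * norm x"
        by (intro mult_right_mono) (auto simp: K_def)
      finally show ?thesis .
    qed
    moreover have "norm (x - x' /\<^sub>R t) \<le> norm x / 2"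
    proof -
      have "x - x' /\<^sub>R t = (t *\<^sub>R x - x') /\<^sub>R t"
        using t by (simp add: scaleR_diff_right)
      then have "norm (x - x' /\<^sub>R t) = norm (t *\<^sub>R x - x') / t"
        using t by (metis abs_of_pos divide_inverse_commute norm_scaleR positive_imp_inverse_positive)
      moreover have "norm (t *\<^sub>R x - x') / t \<le> norm x / 2"
        using z(3) t by (simp add: field_simps)
      ultimately show ?thesis by simp
    qed
    ultimately show ?thesis by blast
  qed
  then obtain p w where pw: "\<And>x. U (w x) = V (p x)" "\<And>x. norm (w x) \<le> K * norm x"
      "\<And>x. norm (x - p x) \<le> norm x / 2"
    by metis
  have "\<exists>z. U z = V x \<and> norm z \<le> (2 * K) * norm x" for x
  proof -
    \<comment> \<open>Successive approximation: \<open>R n\<close> is the error after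
      \<open>n\<close> corrections. Its norm at least halves each time, so the
      \<open>w (R n)\<close> are summable, and the images
      \<open>U (w (R n)) = V (R n) - V (R (Suc n))\<close> telescope to \<open>V x\<close>.\<close>
    define R where "R n = ((\<lambda>y. y - p y) ^^ n) x" for n
    have R0: "R 0 = x" and RS: "\<And>n. R (Suc n) = R n - p (R n)" by (auto simp: R_def)
    have nR: "norm (R n) \<le> norm x * (1/2) ^ n" for n
    proof (induction n)
      case (Suc n)
      then show ?case using pw(3)[of "R n"] by (simp add: RS)
    qed (simp add: R0)
    have nw: "norm (w (R n)) \<le> (K * norm x) * (1/2) ^ n" for n
      using order_trans[OF pw(2)[of "R n"] mult_left_mono[OF nR[of n]]] K by (simp add: mult.assoc)
    have geo: "(\<lambda>n. (K * norm x) * (1/2) ^ n) sums ((K * norm x) * 2)"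
      using sums_mult[OF geometric_sums[of "1/2::real"], of "K * norm x"] by simp
    have sw: "summable (\<lambda>n. w (R n))"
      by (rule summable_comparison_test'[OF sums_summable[OF geo], of 0]) (use nw in auto)
    have "norm (\<Sum>n. w (R n)) \<le> (K * norm x) * 2"
      using norm_suminf_le[OF nw sums_summable[OF geo]] sums_unique[OF geo] by simp
    moreover have "U (\<Sum>n. w (R n)) = V x"
    proof -
      have "(\<lambda>n. norm x * (1/2) ^ n) \<longlonglongrightarrow> norm x * 0"
        by (intro tendsto_mult tendsto_const LIMSEQ_realpow_zero) auto
      then have "(\<lambda>n. norm x * (1/2) ^ n) \<longlonglongrightarrow> 0" by simp
      then have "R \<longlonglongrightarrow> 0"
        by (rule Lim_null_comparison[rotated]) (use nR in auto)
      then have "(\<lambda>n. V (R n)) \<longlonglongrightarrow> V 0"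
        by (rule V.tendsto)
      then have "(\<lambda>n. V (R n) - V (R (Suc n))) sums (V (R 0) - V 0)"
        by (rule telescope_sums')
      moreover have "V (R n) - V (R (Suc n)) = U (w (R n))" for n
        by (simp add: RS V.diff pw(1))
      ultimately have "(\<lambda>n. U (w (R n))) sums V x"
        by (simp add: R0 V.zero)
      then show ?thesis
        using U.suminf[OF sw] sums_unique by metis
    qed
    ultimately show ?thesis by (auto simp: algebra_simps)
  qed
  then show thesis using that[of "2 * K"] K by simp
qed

section \<open>Bounded complex-linear operators\<close>

lemma bounded_linear_scaleC_right: "bounded_linear (\<lambda>x::'a::complex_normed_vector. c *\<^sub>C x)"
proof (rule bounded_linear_intro[of _ "cmod c"])
  fix r and x :: 'a
  show "c *\<^sub>C r *\<^sub>R x = r *\<^sub>R c *\<^sub>C x"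
    by (simp add: scaleR_scaleC scaleC_scaleC mult.commute)
qed (auto simp: scaleC_add_right norm_scaleC mult.commute)

lemma bounded_linear_scaleC_left: "bounded_linear (\<lambda>c. c *\<^sub>C (x::'a::complex_normed_vector))"
proof (rule bounded_linear_intro[of _ "norm x"])
  fix r c
  show "(r *\<^sub>R c) *\<^sub>C x = r *\<^sub>R c *\<^sub>C x"
    by (simp add: scaleR_scaleC[of r "c *\<^sub>C x"] scaleC_scaleC scaleR_conv_of_real)
qed (auto simp: scaleC_add_left norm_scaleC)

lemma bounded_clinear_linear: "bounded_clinear S \<Longrightarrow> bounded_linear S"
  by (simp add: bounded_clinear_def)

lemma bounded_clinear_scaleC: "bounded_clinear S \<Longrightarrow> S (c *\<^sub>C x) = c *\<^sub>C S x"
  by (simp add: bounded_clinear_def)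

lemma bounded_clinear_compose:
  "bounded_clinear R \<Longrightarrow> bounded_clinear S \<Longrightarrow> bounded_clinear (R \<circ> S)"
  by (simp add: bounded_clinear_def bounded_linear_compose o_def)

lemma bounded_clinear_funpow:
  fixes S :: "'a::complex_normed_vector \<Rightarrow> 'a"
  assumes "bounded_clinear S"
  shows "bounded_clinear (S ^^ n)"
  using assms
proof (induction n)
  case 0
  then show ?case by (simp add: bounded_clinear_def id_def)
next
  case (Suc n)
  then show ?case using bounded_clinear_compose[of S "S ^^ n"] by (simp add: o_def)
qed

lemma bounded_clinear_minus_scalar: "bounded_clinear T \<Longrightarrow> bounded_clinear (minus_scalar T c)"
  unfolding bounded_clinear_def minus_scalar_def
  by (auto intro!: bounded_linear_sub bounded_linear_scaleC_right
      simp: complex_vector.scale_right_diff_distrib scaleC_scaleC mult.commute)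

section \<open>Vector-valued power series\<close>

definition cpowser :: "(nat \<Rightarrow> 'a::complex_banach) \<Rightarrow> complex \<Rightarrow> 'a"
  where "cpowser y z = (\<Sum>n. z ^ n *\<^sub>C y n)"

lemma summable_cpowser:
  fixes y :: "nat \<Rightarrow> 'a::complex_banach"
  assumes y: "\<And>n. norm (y n) \<le> K * C ^ n" and C: "C > 0" and z: "cmod z < 1 / C"
  shows "summable (\<lambda>n. z ^ n *\<^sub>C y n)"
proof (rule summable_comparison_test'[where N = 0])
  show "summable (\<lambda>n. K * (cmod z * C) ^ n)"
    using C z by (intro summable_mult summable_geometric) (simp add: field_simps)
  show "norm (z ^ n *\<^sub>C y n) \<le> K * (cmod z * C) ^ n" for n
    using mult_left_mono[OF y[of n], of "cmod z ^ n"]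
    by (simp add: norm_scaleC norm_power power_mult_distrib mult_ac)
qed

lemma cpowser_0: "cpowser y 0 = y 0"
proof -
  have "(\<lambda>n. 0 ^ n *\<^sub>C y n) sums (\<Sum>n\<in>{0}. 0 ^ n *\<^sub>C y n)"
    by (rule sums_finite) auto
  then show ?thesis by (simp add: cpowser_def sums_iff scaleC_one)
qed

text \<open>If \<open>A (y (Suc n)) = y n\<close>, then \<open>A\<close> maps the shifted series
  \<open>w\<close> to the whole one, and this identity becomes the equation
  \<open>A w - z w = y 0\<close>.\<close>

lemma cpowser_split_head:
  fixes y :: "nat \<Rightarrow> 'a::complex_banach"
  assumes y: "\<And>n. norm (y n) \<le> K * C ^ n" and C: "C > 0" and z: "cmod z < 1 / C"
  shows "cpowser y z = y 0 + z *\<^sub>C cpowser (\<lambda>n. y (Suc n)) z"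
proof -
  have y': "norm (y (Suc n)) \<le> (K * C) * C ^ n" for n
    using y[of "Suc n"] by (simp add: mult_ac)
  have "z *\<^sub>C cpowser (\<lambda>n. y (Suc n)) z = (\<Sum>n. z *\<^sub>C z ^ n *\<^sub>C y (Suc n))"
    unfolding cpowser_def
    by (rule bounded_linear.suminf[OF bounded_linear_scaleC_right]) (rule summable_cpowser[OF y' C z])
  then show ?thesis
    using suminf_split_head[OF summable_cpowser[OF y C z]]
    by (simp add: cpowser_def scaleC_scaleC scaleC_one)
qed

lemma bounded_clinear_cpowser:
  fixes y :: "nat \<Rightarrow> 'a::complex_banach"
  assumes A: "bounded_clinear A"
    and y: "\<And>n. norm (y n) \<le> K * C ^ n" and C: "C > 0" and z: "cmod z < 1 / C"
  shows "A (cpowser y z) = cpowser (\<lambda>n. A (y n)) z"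
  unfolding cpowser_def
  using bounded_linear.suminf[OF bounded_clinear_linear[OF A] summable_cpowser[OF y C z]]
  by (simp add: bounded_clinear_scaleC[OF A])

text \<open>Termwise differentiation, justified by uniform convergence of the differentiated series
  on a ball of radius strictly between \<open>cmod z\<close> and \<open>1 / C\<close>.\<close>

lemma has_derivative_cpowser:
  fixes y :: "nat \<Rightarrow> 'a::complex_banach"
  assumes y: "\<And>n. norm (y n) \<le> K * C ^ n" and C: "C > 0" and z: "cmod z < 1 / C"
  obtains D where "(cpowser y has_derivative (\<lambda>h. h *\<^sub>C D)) (at z)"
proof -
  obtain r where r: "cmod z < r" "r < 1 / C"
    using z dense by blast
  define s where "s = r * C"
  have r0: "r > 0" using r(1) by (smt (verit) norm_ge_zero)
  have s: "s > 0" "s < 1" using r r0 C by (auto simp: s_def field_simps)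
  have K0: "K \<ge> 0" using y[of 0] norm_ge_zero order_trans by (metis mult_1_right power_0)
  \<comment> \<open>The derivative of the n-th term; for \<open>n = 0\<close> the truncated exponent
    \<open>n - 1\<close> is harmless because the factor \<open>of_nat n\<close> vanishes.\<close>
  define t where "t n w = (of_nat n * w ^ (n - 1)) *\<^sub>C y n" for n w
  have "summable (\<lambda>n. of_nat n * s ^ (n - 1))"
    using sums_summable[OF geometric_deriv_sums[of s]] s
      summable_Suc_iff[of "\<lambda>n. of_nat n * s ^ (n - 1)"] by simp
  then have sm: "summable (\<lambda>n. (K * C) * (of_nat n * s ^ (n - 1)))"
    by (rule summable_mult)
  have bt: "norm (t n w) \<le> (K * C) * (of_nat n * s ^ (n - 1))" if w: "w \<in> ball 0 r" for n w
  proof (cases n)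
    case (Suc m)
    have "cmod w ^ m \<le> r ^ m" using w by (intro power_mono) auto
    then have "(of_nat n * cmod w ^ m) * norm (y n) \<le> (of_nat n * r ^ m) * (K * C ^ n)"
      using y[of n] r0 by (intro mult_mono) auto
    also have "\<dots> = (K * C) * (of_nat n * s ^ m)"
      by (simp add: Suc s_def power_mult_distrib)
    finally show ?thesis
      by (simp add: t_def Suc norm_scaleC norm_mult norm_power del: of_nat_Suc)
  qed (simp add: t_def)
  have ul: "uniform_limit (ball 0 r) (\<lambda>n w. \<Sum>i<n. t i w) (\<lambda>w. \<Sum>i. t i w) sequentially"
    by (rule Weierstrass_m_test[OF bt sm])
  have zr: "z \<in> ball 0 r" using r by simp
  have "\<exists>g. \<forall>w\<in>ball 0 r. (\<lambda>n. w ^ n *\<^sub>C y n) sums g w \<and>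
      (g has_derivative (\<lambda>h. h *\<^sub>C (\<Sum>i. t i w))) (at w within ball 0 r)"
  proof (rule has_derivative_series[where x = z and f' = "\<lambda>n w h. h *\<^sub>C t n w"])
    show "((\<lambda>w. w ^ n *\<^sub>C y n) has_derivative (\<lambda>h. h *\<^sub>C t n w)) (at w within ball 0 r)" for n w
    proof -
      have "((\<lambda>w. w ^ n) has_derivative (\<lambda>h. h * (of_nat n * w ^ (n - 1)))) (at w within ball 0 r)"
        by (auto intro!: derivative_eq_intros simp: mult_ac)
      from bounded_linear.has_derivative[OF bounded_linear_scaleC_left this]
      show ?thesis by (simp add: t_def scaleC_scaleC)
    qed
    show "\<forall>\<^sub>F n in sequentially. \<forall>w\<in>ball 0 r. \<forall>h.
        norm ((\<Sum>i<n. h *\<^sub>C t i w) - h *\<^sub>C (\<Sum>i. t i w)) \<le> e * norm h" if "e > 0" for e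
    proof -
      have "\<forall>\<^sub>F n in sequentially. \<forall>w\<in>ball 0 r. dist (\<Sum>i<n. t i w) (\<Sum>i. t i w) < e"
        using ul that by (simp add: uniform_limit_iff)
      then show ?thesis
      proof (rule eventually_mono, intro ballI allI)
        fix n w h
        assume *: "\<forall>w\<in>ball 0 r. dist (\<Sum>i<n. t i w) (\<Sum>i. t i w) < e" and "w \<in> ball (0::complex) r"
        then have "norm ((\<Sum>i<n. t i w) - (\<Sum>i. t i w)) \<le> e"
          by (auto simp: dist_norm less_imp_le)
        then have "cmod h * norm ((\<Sum>i<n. t i w) - (\<Sum>i. t i w)) \<le> e * norm h"
          by (subst mult.commute) (simp add: mult_right_mono)
        then show "norm ((\<Sum>i<n. h *\<^sub>C t i w) - h *\<^sub>C (\<Sum>i. t i w)) \<le> e * norm h"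
          by (simp flip: complex_vector.scale_sum_right complex_vector.scale_right_diff_distrib
              add: norm_scaleC)
      qed
    qed
    show "(\<lambda>n. z ^ n *\<^sub>C y n) sums cpowser y z"
      unfolding cpowser_def using summable_cpowser[OF y C z] by (rule summable_sums)
  qed (use zr in auto)
  then obtain g where g: "\<And>w. w \<in> ball 0 r \<Longrightarrow> (\<lambda>n. w ^ n *\<^sub>C y n) sums g w"
      "(g has_derivative (\<lambda>h. h *\<^sub>C (\<Sum>i. t i z))) (at z within ball 0 r)"
    using zr by blast
  have "(cpowser y has_derivative (\<lambda>h. h *\<^sub>C (\<Sum>i. t i z))) (at z)"
  proof (rule has_derivative_transform_within_open)
    show "(g has_derivative (\<lambda>h. h *\<^sub>C (\<Sum>i. t i z))) (at z)"
      using g(2) zr by (simp add: at_within_open_NO_MATCH)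
    show "g w = cpowser y w" if "w \<in> ball 0 r" for w
      using g(1)[OF that] by (simp add: cpowser_def sums_iff)
  qed (use zr in auto)
  then show thesis by (rule that)
qed

section \<open>Surjectivity and eigenvectors near a point of finite descent\<close>

lemma scalar_minus_eq: "scalar_minus z T v = (z - c) *\<^sub>C v - minus_scalar T c v"
  by (simp add: scalar_minus_def minus_scalar_def complex_vector.scale_left_diff_distrib)

lemma bounded_clinear_scalar_minus: "bounded_clinear T \<Longrightarrow> bounded_clinear (scalar_minus c T)"
  unfolding bounded_clinear_def scalar_minus_def
  by (auto intro!: bounded_linear_sub bounded_linear_scaleC_right
      simp: complex_vector.scale_right_diff_distrib scaleC_scaleC mult.commute)

text \<open>The bounded lift of \<open>A ^^ q\<close> through \<open>A ^^ Suc q\<close> gives a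
  choice \<open>g\<close>, not necessarily linear, whose iterates produce the orbit.
  \<open>C\<close> is fixed before the starting point and only \<open>K\<close> depends on it, so
  all power series along these orbits converge on the disc of radius \<open>1 / C\<close>.\<close>

lemma ex_backward_orbit:
  fixes A :: "'a::complex_banach \<Rightarrow> 'a"
  assumes A: "bounded_clinear A" and desc: "range (A ^^ q) = range (A ^^ Suc q)"
  obtains C where "C > 0"
    "\<And>x. x \<in> range (A ^^ q) \<Longrightarrow>
      \<exists>y K. y 0 = x \<and> (\<forall>n. A (y (Suc n)) = y n) \<and> (\<forall>n. norm (y n) \<le> K * C ^ n)"
proof -
  have lin: "bounded_linear (A ^^ n)" for n
    using A by (intro bounded_clinear_linear bounded_clinear_funpow)
  obtain C where C: "C > 0"
    and ex: "\<And>x. \<exists>z. (A ^^ Suc q) z = (A ^^ q) x \<and> norm z \<le> C * norm x"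
    using range_le_imp_norm_bounded_lift[OF lin lin, of q "Suc q"] desc by auto
  obtain g where g: "\<And>x. (A ^^ Suc q) (g x) = (A ^^ q) x" "\<And>x. norm (g x) \<le> C * norm x"
    using ex by metis
  obtain B where B: "B > 0" "\<And>x. norm ((A ^^ q) x) \<le> norm x * B"
    using bounded_linear.pos_bounded[OF lin] by blast
  have "\<exists>y K. y 0 = (A ^^ q) u \<and> (\<forall>n. A (y (Suc n)) = y n) \<and> (\<forall>n. norm (y n) \<le> K * C ^ n)" for u
  \<comment> \<open>The witnesses are \<open>y n = (A ^^ q) ((g ^^ n) u)\<close> and
    \<open>K = norm u * B\<close>.\<close>
  proof (intro exI conjI allI)
    show "(A ^^ q) ((g ^^ 0) u) = (A ^^ q) u" by simp
    show "A ((A ^^ q) ((g ^^ Suc n) u)) = (A ^^ q) ((g ^^ n) u)" for n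
      using g(1)[of "(g ^^ n) u"] by simp
    have ng: "norm ((g ^^ n) u) \<le> norm u * C ^ n" for n
    proof (induction n)
      case (Suc n)
      then show ?case
        using order_trans[OF g(2)[of "(g ^^ n) u"] mult_left_mono[OF Suc]] C by (simp add: mult_ac)
    qed simp
    show "norm ((A ^^ q) ((g ^^ n) u)) \<le> (norm u * B) * C ^ n" for n
      using order_trans[OF B(2)[of "(g ^^ n) u"] mult_right_mono[OF ng[of n]]] B(1)
      by (simp add: mult_ac)
  qed
  then show thesis using that[OF C] by blast
qed

text \<open>The power series along a backward orbit shows that the range of \<open>z - T\<close>
  contains \<open>range (minus_scalar T c ^^ q)\<close>; stripping off the \<open>q\<close> powers
  one at a time then reaches every vector.\<close>

lemma finite_descent_imp_surj_near:
  fixes T :: "'a::complex_banach \<Rightarrow> 'a"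
  assumes T: "bounded_clinear T"
    and desc: "range (minus_scalar T c ^^ q) = range (minus_scalar T c ^^ Suc q)"
  obtains r where "r > 0" "\<And>z. z \<in> ball c r \<Longrightarrow> z \<noteq> c \<Longrightarrow> surj (scalar_minus z T)"
proof -
  let ?A = "minus_scalar T c"
  have A: "bounded_clinear ?A" using T by (rule bounded_clinear_minus_scalar)
  obtain C where C: "C > 0" and orb: "\<And>x. x \<in> range (?A ^^ q) \<Longrightarrow>
      \<exists>y K. y 0 = x \<and> (\<forall>n. ?A (y (Suc n)) = y n) \<and> (\<forall>n. norm (y n) \<le> K * C ^ n)"
    using ex_backward_orbit[OF A desc] by metis
  have "surj (scalar_minus z T)" if zr: "z \<in> ball c (1 / C)" and zc: "z \<noteq> c" for z
  proof -
    let ?S = "scalar_minus z T"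
    define m where "m = z - c"
    have m: "m \<noteq> 0" "cmod m < 1 / C"
      using zr zc by (auto simp: m_def dist_norm norm_minus_commute)
    have S: "?S v = m *\<^sub>C v - ?A v" for v
      unfolding m_def by (rule scalar_minus_eq)
    have clin: "bounded_clinear ?S" using T by (rule bounded_clinear_scalar_minus)
    interpret S: bounded_linear ?S using clin by (rule bounded_clinear_linear)
    have ran: "(?A ^^ q) v \<in> range ?S" for v
    proof -
      obtain y K where y: "y 0 = (?A ^^ q) v" "\<And>n. ?A (y (Suc n)) = y n" "\<And>n. norm (y n) \<le> K * C ^ n"
        using orb[of "(?A ^^ q) v"] by blast
      have y': "norm (y (Suc n)) \<le> (K * C) * C ^ n" for n
        using y(3)[of "Suc n"] by (simp add: mult_ac)
      let ?w = "cpowser (\<lambda>n. y (Suc n)) m"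
      have "?A ?w = cpowser y m"
        using bounded_clinear_cpowser[OF A y' C m(2)] by (simp add: y(2))
      also have "\<dots> = y 0 + m *\<^sub>C ?w"
        by (rule cpowser_split_head[OF y(3) C m(2)])
      \<comment> \<open>The series gives \<open>A w - m w = y 0\<close>, while
        \<open>scalar_minus z T\<close> is \<open>m - A\<close>; hence the sign.\<close>
      finally have "?S (- ?w) = y 0"
        unfolding S.neg by (simp add: S)
      then show ?thesis using y(1) by (metis rangeI)
    qed
    \<comment> \<open>Modulo \<open>R(S)\<close> the operator \<open>A\<close> acts as the nonzero scalar \<open>m\<close>.\<close>
    have descend: "v \<in> range ?S" if "(?A ^^ n) v \<in> range ?S" for n v
      using that
    proof (induction n arbitrary: v)
      case (Suc n)
      from Suc.prems have "(?A ^^ n) (?A v) \<in> range ?S"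
        by (simp add: funpow_swap1)
      then obtain u where "?A v = ?S u" using Suc.IH by blast
      moreover have "m *\<^sub>C v = ?S v + ?A v" by (simp add: S)
      ultimately have mv: "m *\<^sub>C v = ?S (v + u)" by (simp only: S.add)
      then have "v = ?S (inverse m *\<^sub>C (v + u))"
        using m(1) by (simp add: bounded_clinear_scaleC[OF clin] scaleC_scaleC scaleC_one
            flip: mv)
      then show ?case by blast
    qed simp
    show ?thesis using descend[OF ran] by blast
  qed
  then show thesis using that[of "1 / C"] C by simp
qed

text \<open>Along a backward orbit starting at a kernel vector of \<open>T - c\<close>, the power
  series in \<open>z - c\<close> satisfies the eigenvalue equation for \<open>z\<close>. Its value
  at \<open>c\<close> is \<open>x\<close>, so continuity keeps it nonzero on a smaller ball.\<close>

lemma ex_local_eigenvector_family: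
  fixes T :: "'a::complex_banach \<Rightarrow> 'a"
  assumes T: "bounded_clinear T"
    and desc: "range (minus_scalar T c ^^ q) = range (minus_scalar T c ^^ Suc q)"
    and x: "x \<in> range (minus_scalar T c ^^ q)" "minus_scalar T c x = 0" "x \<noteq> 0"
  obtains r f where "r > 0" "vec_holomorphic_on f (ball c r)"
    "\<And>z. z \<in> ball c r \<Longrightarrow> scalar_minus z T (f z) = 0" "\<And>z. z \<in> ball c r \<Longrightarrow> f z \<noteq> 0"
proof -
  let ?A = "minus_scalar T c"
  have A: "bounded_clinear ?A" using T by (rule bounded_clinear_minus_scalar)
  obtain C y K where C: "C > 0" and y: "y 0 = x" "\<And>n. ?A (y (Suc n)) = y n" "\<And>n. norm (y n) \<le> K * C ^ n"
    using ex_backward_orbit[OF A desc] x(1) by metis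
  define f where "f z = cpowser y (z - c)" for z
  have der: "\<exists>D. (f has_derivative (\<lambda>h. h *\<^sub>C D)) (at z)" if z: "z \<in> ball c (1 / C)" for z
  proof -
    have "cmod (z - c) < 1 / C"
      using z by (simp add: dist_norm norm_minus_commute)
    then obtain D where "(cpowser y has_derivative (\<lambda>h. h *\<^sub>C D)) (at (z - c))"
      using has_derivative_cpowser[OF y(3) C] by blast
    moreover have "((\<lambda>z. z - c) has_derivative (\<lambda>h. h)) (at z)"
      by (auto intro!: derivative_eq_intros)
    ultimately have "(f has_derivative (\<lambda>h. h *\<^sub>C D)) (at z)"
      unfolding f_def using has_derivative_compose[of "\<lambda>z. z - c" "\<lambda>h. h" z UNIV "cpowser y"] by simp
    then show ?thesis by blast
  qed
  have "f c = x" by (simp add: f_def cpowser_0 y(1))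
  moreover have "isCont f c"
    using der[of c] C has_derivative_continuous by auto
  ultimately obtain e where e: "e > 0" "\<And>z. z \<in> ball c e \<Longrightarrow> f z \<noteq> 0"
    using continuous_at_avoid[of c f 0] x(3) by (auto simp: dist_commute)
  have eig: "scalar_minus z T (f z) = 0" if z: "z \<in> ball c (1 / C)" for z
  proof -
    define m where "m = z - c"
    have m: "cmod m < 1 / C"
      using z by (simp add: m_def dist_norm norm_minus_commute)
    obtain M where M: "M > 0" "\<And>v. norm (?A v) \<le> norm v * M"
      using bounded_linear.pos_bounded[OF bounded_clinear_linear[OF A]] by blast
    have Ay: "norm (?A (y n)) \<le> (K * M) * C ^ n" for n
      using order_trans[OF M(2)[of "y n"] mult_right_mono[OF y(3)[of n]]] M(1) by (simp add: mult_ac)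
    have "?A (f z) = cpowser (\<lambda>n. ?A (y n)) m"
      unfolding f_def m_def[symmetric] by (rule bounded_clinear_cpowser[OF A y(3) C m])
    \<comment> \<open>The head \<open>?A (y 0)\<close> is \<open>?A x = 0\<close>, and the shifted
      tail \<open>?A (y (Suc n)) = y n\<close> returns the series itself.\<close>
    also have "\<dots> = m *\<^sub>C f z"
      using cpowser_split_head[OF Ay C m] by (simp add: y(1,2) x(2) f_def m_def)
    finally show ?thesis
      by (simp add: scalar_minus_eq[of z T _ c] m_def)
  qed
  show thesis
  proof (rule that[of "min e (1 / C)" f])
    show "vec_holomorphic_on f (ball c (min e (1 / C)))"
      unfolding vec_holomorphic_on_def by (auto intro!: der simp: at_within_open_NO_MATCH)
  qed (use C e eig in auto)
qed

section \<open>Surjective operators that are not injective, and the spectral conditions\<close>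

lemma surj_not_inj_imp_infinite_ascent:
  assumes S: "bounded_clinear S" and sur: "surj S" and ninj: "\<not> inj S"
  shows "ascent S = \<infinity>"
proof -
  interpret S: bounded_linear S using S by (rule bounded_clinear_linear)
  obtain x where x: "x \<noteq> 0" "S x = 0"
    using ninj by (metis S.diff right_minus_eq injI)
  \<comment> \<open>A preimage under \<open>S ^^ p\<close> of a nonzero kernel vector is killed by
    the next power but not by this one.\<close>
  have "op_kernel (S ^^ p) \<noteq> op_kernel (S ^^ Suc p)" for p
  proof -
    have "surj (S ^^ p)" using sur by (rule surj_fn)
    then obtain y where y: "(S ^^ p) y = x" by (metis surjD)
    then have "y \<in> op_kernel (S ^^ Suc p)" "y \<notin> op_kernel (S ^^ p)"
      using x by (auto simp: op_kernel_def)
    then show ?thesis by blast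
  qed
  then show ?thesis by (simp add: ascent_def top_enat_def)
qed

lemma surj_not_inj_imp_pos_index:
  assumes S: "bounded_clinear S" and sur: "surj S" and ninj: "\<not> inj S"
  shows "\<not> fredholm_index S \<le> 0"
proof
  assume le: "fredholm_index S \<le> 0"
  interpret S: bounded_linear S using S by (rule bounded_clinear_linear)
  have "quotient_basis UNIV ({} :: 'a set)"
    by (simp add: quotient_basis_def complex_vector.independent_empty)
  then have "defect S = 0"
    using ccodim_eq_card[of UNIV "{} :: 'a set"] sur by (simp add: defect_def zero_enat_def)
  \<comment> \<open>With defect 0 the index is the nullity as an extended real, so \<open>le\<close>
    also excludes infinite nullity.\<close>
  with le have "nullity S = 0"
    by (cases "nullity S") (auto simp: fredholm_index_def zero_enat_def zero_ereal_def)
  then obtain B where B: "finite B" "op_kernel S \<subseteq> complex_vector.span B"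
      and dim: "complex_vector.dim (op_kernel S) = 0"
    by (auto simp: nullity_def cdim_def zero_enat_def split: if_splits)
  obtain D where D: "D \<subseteq> op_kernel S" "complex_vector.independent D"
      "op_kernel S \<subseteq> complex_vector.span D" "card D = complex_vector.dim (op_kernel S)"
    using complex_vector.basis_exists by metis
  \<comment> \<open>Since \<open>card\<close> is 0 on infinite sets, \<open>card D = 0\<close> alone
    would not give \<open>D = {}\<close>.\<close>
  have "finite D"
    using complex_vector.independent_span_bound[OF B(1) D(2)] D(1) B(2) by auto
  with D(4) dim have "D = {}" by simp
  with D(3) have "op_kernel S \<subseteq> {0}" by simp
  moreover obtain x where "x \<noteq> 0" "S x = 0"
    using ninj by (metis S.diff right_minus_eq injI)
  ultimately show False by (auto simp: op_kernel_def)
qed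

text \<open>A nonzero \<open>x\<close> would put a punctured ball inside each of the five spectra
  with supposedly empty interior, and it refutes the other two alternatives of \<open>cond\<close>
  separately.\<close>

lemma finite_descent_imp_kernel_range_trivial:
  fixes T :: "'a::complex_banach \<Rightarrow> 'a"
  assumes T: "bounded_clinear T"
    and cond: "op_spectrum T = surjectivity_spectrum T
       \<or> interior (approx_point_spectrum T) = {}
       \<or> interior (point_spectrum T) = {}
       \<or> interior (ascent_spectrum T) = {}
       \<or> interior (upper_browder_spectrum T) = {}
       \<or> interior (upper_weyl_spectrum T) = {}
       \<or> non_svep_set T = {}"
    and desc: "range (minus_scalar T c ^^ q) = range (minus_scalar T c ^^ Suc q)"
    and x: "x \<in> range (minus_scalar T c ^^ q)" "minus_scalar T c x = 0"
  shows "x = 0"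
proof (rule ccontr)
  assume "x \<noteq> 0"
  then obtain r1 f where r1: "r1 > 0" "vec_holomorphic_on f (ball c r1)"
    and eig: "\<And>z. z \<in> ball c r1 \<Longrightarrow> scalar_minus z T (f z) = 0"
    and nz: "\<And>z. z \<in> ball c r1 \<Longrightarrow> f z \<noteq> 0"
    using ex_local_eigenvector_family[OF T desc x] by metis
  obtain r2 where r2: "r2 > 0" "\<And>z. z \<in> ball c r2 \<Longrightarrow> z \<noteq> c \<Longrightarrow> surj (scalar_minus z T)"
    using finite_descent_imp_surj_near[OF T desc] by metis
  \<comment> \<open>Surjectivity is known only away from \<open>c\<close>, so the centre is removed;
    \<open>P\<close> stays open and nonempty, as the interiors require.\<close>
  define P where "P = ball c (min r1 r2) - {c}"
  have P: "open P" by (simp add: P_def open_delete)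
  have "c + of_real (min r1 r2 / 2) \<in> P"
    using r1(1) r2(1) by (auto simp: P_def dist_norm simp del: of_real_divide)
  then have ne: "P \<noteq> {}" by blast
  have lin: "bounded_clinear (scalar_minus z T)" for z
    using T by (rule bounded_clinear_scalar_minus)
  have zero: "scalar_minus z T 0 = 0" for z
    using bounded_linear.linear[OF bounded_clinear_linear[OF lin[of z]]] by (rule linear_0)
  have sur: "surj (scalar_minus z T)" if "z \<in> P" for z
    using that r2(2) by (auto simp: P_def)
  have ninj: "\<not> inj (scalar_minus z T)" if "z \<in> P" for z
  proof -
    have "scalar_minus z T (f z) = scalar_minus z T 0" "f z \<noteq> 0"
      using that eig[of z] nz[of z] zero[of z] by (auto simp: P_def)
    then show ?thesis by (metis injD)
  qed
  have no: "interior X \<noteq> {}" if "P \<subseteq> X" for X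
    using interior_maximal[OF that P] ne by blast
  have point: "P \<subseteq> point_spectrum T"
    using ninj by (auto simp: point_spectrum_def)
  have approx: "P \<subseteq> approx_point_spectrum T"
  proof
    fix z assume "z \<in> P"
    then have "scalar_minus z T (f z) = 0" "f z \<noteq> 0"
      using eig nz by (auto simp: P_def)
    then have "\<not> c * norm (f z) \<le> norm (scalar_minus z T (f z))" if "c > 0" for c
      using that by (simp add: mult_le_0_iff)
    then show "z \<in> approx_point_spectrum T"
      unfolding approx_point_spectrum_def bounded_below_def by blast
  qed
  have asc: "P \<subseteq> ascent_spectrum T"
    using surj_not_inj_imp_infinite_ascent[OF lin sur ninj] by (auto simp: ascent_spectrum_def)
  then have browder: "P \<subseteq> upper_browder_spectrum T"
    by (auto simp: upper_browder_spectrum_def upper_semi_browder_def ascent_spectrum_def)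
  have weyl: "P \<subseteq> upper_weyl_spectrum T"
    using surj_not_inj_imp_pos_index[OF lin sur ninj]
    by (auto simp: upper_weyl_spectrum_def upper_semi_weyl_def)
  \<comment> \<open>Here the centre counts: \<open>f\<close> is a nonvanishing solution on the full
    ball.\<close>
  have "\<not> svep_at T c"
  proof
    assume "svep_at T c"
    then have "\<forall>z\<in>ball c r1. f z = 0"
      unfolding svep_at_def using r1 eig by (meson open_ball centre_in_ball)
    then show False using nz[of c] r1(1) by simp
  qed
  then have "c \<in> non_svep_set T" by (simp add: non_svep_set_def)
  \<comment> \<open>The only alternative left; it makes a surjective \<open>z - T\<close>
    invertible, hence injective.\<close>
  then have "op_spectrum T = surjectivity_spectrum T"
    using cond no[OF point] no[OF approx] no[OF asc] no[OF browder] no[OF weyl] by blast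
  moreover obtain z where "z \<in> P" using ne by blast
  ultimately have "invertible_op (scalar_minus z T)"
    using sur by (auto simp: op_spectrum_def surjectivity_spectrum_def)
  then have "inj (scalar_minus z T)"
    unfolding invertible_op_def by (metis inj_on_id inj_on_imageI2)
  with ninj \<open>z \<in> P\<close> show False by blast
qed

section \<open>The bounded factor\<close>

text \<open>By \<open>triv\<close>, \<open>A ^^ Suc q\<close> is injective on
  \<open>range (A ^^ q)\<close>, so a solution chosen there is unique and hence linear in the data.
  This range is not assumed closed, so the norm bound is taken from preimages \<open>g x\<close> in
  the whole Banach space.\<close>

lemma ex_bounded_factor:
  fixes A :: "'a::complex_banach \<Rightarrow> 'a"
  assumes A: "bounded_clinear A" and desc: "range (A ^^ q) = range (A ^^ Suc q)"
    and triv: "\<And>x. x \<in> range (A ^^ q) \<Longrightarrow> A x = 0 \<Longrightarrow> x = 0"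
  obtains S where "bounded_clinear S" "A ^^ q = A ^^ Suc q \<circ> S"
proof -
  define M where "M = range (A ^^ q)"
  have clin: "bounded_clinear (A ^^ n)" for n
    using A by (rule bounded_clinear_funpow)
  have lin: "bounded_linear (A ^^ n)" for n
    using clin by (rule bounded_clinear_linear)
  interpret A: bounded_linear A using A by (rule bounded_clinear_linear)
  interpret Q: bounded_linear "A ^^ q" by (rule lin)
  have M_diff: "x - y \<in> M" if "x \<in> M" "y \<in> M" for x y
  proof -
    obtain u v where "x = (A ^^ q) u" "y = (A ^^ q) v"
      using \<open>x \<in> M\<close> \<open>y \<in> M\<close> by (auto simp: M_def)
    then have "x - y = (A ^^ q) (u - v)" by (simp add: Q.diff)
    then show ?thesis by (simp add: M_def)
  qed
  have M_A: "A x \<in> M" if "x \<in> M" for x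
    using that by (auto simp: M_def funpow_swap1)
  have pull: "\<exists>y\<in>M. (A ^^ n) y = x" if "x \<in> M" for x n
    using that
  proof (induction n arbitrary: x)
    case (Suc n)
    then obtain u where "x = A ((A ^^ q) u)"
      using desc by (auto simp: M_def)
    moreover have "(A ^^ q) u \<in> M" by (simp add: M_def)
    moreover from this obtain y where "y \<in> M" "(A ^^ n) y = (A ^^ q) u"
      using Suc.IH by blast
    ultimately show ?case by (intro bexI[of _ y]) simp_all
  qed auto
  have inj: "x = y" if "x \<in> M" "y \<in> M" "(A ^^ n) x = (A ^^ n) y" for x y n
    using that
  proof (induction n arbitrary: x y)
    case (Suc n)
    then have "A x = A y"
      using M_A by (simp add: funpow_swap1)
    then show ?case
      using triv[of "x - y"] M_diff Suc.prems by (simp add: A.diff M_def)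
  qed simp
  \<comment> \<open>Lifting through \<open>A ^^ Suc q \<circ> A ^^ q\<close> instead of
    \<open>A ^^ Suc q\<close> places the solution \<open>(A ^^ q) (g x)\<close> in
    \<open>M\<close>.\<close>
  have "range (A ^^ q) \<subseteq> range (A ^^ Suc q \<circ> A ^^ q)"
  proof
    fix x assume "x \<in> range (A ^^ q)"
    then obtain y where "y \<in> M" "(A ^^ Suc q) y = x"
      using pull[of x "Suc q"] by (auto simp: M_def)
    then show "x \<in> range (A ^^ Suc q \<circ> A ^^ q)" by (auto simp: M_def)
  qed
  then obtain C where C: "C > 0"
    and ex: "\<And>x. \<exists>z. (A ^^ Suc q \<circ> A ^^ q) z = (A ^^ q) x \<and> norm z \<le> C * norm x"
    using range_le_imp_norm_bounded_lift[OF
        bounded_clinear_linear[OF bounded_clinear_compose[OF clin[of "Suc q"] clin[of q]]] lin[of q]]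
    by blast
  obtain g where g: "\<And>x. (A ^^ Suc q) ((A ^^ q) (g x)) = (A ^^ q) x" "\<And>x. norm (g x) \<le> C * norm x"
    using ex by (metis comp_apply)
  define S where "S x = (A ^^ q) (g x)" for x
  have SM: "S x \<in> M" for x by (simp add: S_def M_def)
  have AS: "(A ^^ Suc q) (S x) = (A ^^ q) x" for x
    using g(1) by (simp only: S_def)
  obtain B where B: "B > 0" "\<And>x. norm ((A ^^ q) x) \<le> norm x * B"
    using Q.pos_bounded by blast
  \<comment> \<open>\<open>g\<close> is an arbitrary choice, but both sides lie in \<open>M\<close>
    and have the same image under \<open>A ^^ Suc q\<close>. Additivity below works
    likewise.\<close>
  have sc: "S (a *\<^sub>C x) = a *\<^sub>C S x" for a x
  proof (rule inj[OF SM _ , of _ "Suc q"])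
    show "a *\<^sub>C S x \<in> M"
      unfolding S_def M_def by (metis bounded_clinear_scaleC[OF clin] rangeI)
    show "(A ^^ Suc q) (S (a *\<^sub>C x)) = (A ^^ Suc q) (a *\<^sub>C S x)"
      unfolding AS bounded_clinear_scaleC[OF clin] ..
  qed
  have "bounded_linear S"
  proof (rule bounded_linear_intro[of _ "C * B"])
    show "S (x + y) = S x + S y" for x y
    proof (rule inj[OF SM _ , of _ "Suc q"])
      show "S x + S y \<in> M"
        unfolding S_def M_def by (metis Q.add rangeI)
      show "(A ^^ Suc q) (S (x + y)) = (A ^^ Suc q) (S x + S y)"
        unfolding AS linear_add[OF bounded_linear.linear[OF lin]] ..
    qed
    show "S (t *\<^sub>R x) = t *\<^sub>R S x" for t x
      by (simp add: scaleR_scaleC sc)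
    show "norm (S x) \<le> norm x * (C * B)" for x
      using order_trans[OF B(2)[of "g x"] mult_right_mono[OF g(2)[of x]]] B(1)
      by (simp add: S_def mult_ac)
  qed
  with sc have "bounded_clinear S" by (simp add: bounded_clinear_def)
  moreover have "A ^^ q = A ^^ Suc q \<circ> S"
    using AS by (intro ext) simp
  ultimately show thesis by (rule that)
qed

section \<open>Comparing the two descent spectra\<close>

lemma descent_on_finite_iff:
  "descent_on V F \<noteq> \<infinity> \<longleftrightarrow> (\<exists>q. (F ^^ q) ` V = (F ^^ Suc q) ` V)"
proof
  assume "\<exists>q. (F ^^ q) ` V = (F ^^ Suc q) ` V"
  then obtain q where "(F ^^ q) ` V = (F ^^ Suc q) ` V" ..
  then have "descent_on V F \<le> enat q"
    unfolding descent_on_def by (intro INF_lower) simp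
  then show "descent_on V F \<noteq> \<infinity>" by (metis enat_ord_simps(5) enat.distinct(2))
next
  show "\<exists>q. (F ^^ q) ` V = (F ^^ Suc q) ` V" if "descent_on V F \<noteq> \<infinity>"
  proof (rule ccontr)
    assume "\<not> ?thesis"
    then have "{q. (F ^^ q) ` V = (F ^^ Suc q) ` V} = {}" by blast
    with that show False by (simp add: descent_on_def top_enat_def)
  qed
qed

text \<open>The two descent spectra use opposite signs, \<open>c - T\<close> and
  \<open>T - c\<close>; the powers differ by the invertible scalar \<open>(-1) ^ n\<close>.\<close>

lemma range_funpow_scalar_minus:
  assumes T: "bounded_clinear T"
  shows "range (scalar_minus c T ^^ n) = range (minus_scalar T c ^^ n)"
proof -
  let ?A = "minus_scalar T c"
  have A: "bounded_clinear ?A" using T by (rule bounded_clinear_minus_scalar)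
  have neg: "scalar_minus c T = (\<lambda>x. (-1) *\<^sub>C ?A x)"
    by (simp add: fun_eq_iff scalar_minus_def minus_scalar_def scaleC_one)
  have pow: "(scalar_minus c T ^^ n) x = ((-1) ^ n) *\<^sub>C (?A ^^ n) x" for x
    by (induction n) (simp_all add: scaleC_one neg bounded_clinear_scaleC[OF A] scaleC_scaleC)
  show ?thesis
  proof (intro equalityI subsetI)
    fix y assume "y \<in> range (scalar_minus c T ^^ n)"
    then show "y \<in> range (?A ^^ n)"
      unfolding pow bounded_clinear_scaleC[OF bounded_clinear_funpow[OF A], symmetric] by blast
  next
    fix y assume "y \<in> range (?A ^^ n)"
    then obtain x where "y = (?A ^^ n) x" by blast
    also have "\<dots> = (scalar_minus c T ^^ n) ((-1) ^ n *\<^sub>C x)"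
      by (simp add: pow bounded_clinear_scaleC[OF bounded_clinear_funpow[OF A]] scaleC_scaleC
          scaleC_one flip: power_mult_distrib)
    finally show "y \<in> range (scalar_minus c T ^^ n)" by blast
  qed
qed

lemma funpow_left_mult: "(left_mult A ^^ n) S = A ^^ n \<circ> S"
  by (induction n) (simp_all add: left_mult_def o_assoc)

text \<open>Evaluating the equal images at \<open>id\<close> yields the factor \<open>S\<close>;
  conversely, composing on the right with any \<open>R\<close> carries the factorization over to
  \<open>R\<close>.\<close>

lemma left_mult_stable_iff:
  fixes A :: "'a::complex_normed_vector \<Rightarrow> 'a"
  assumes A: "bounded_clinear A"
  shows "(left_mult A ^^ q) ` bounded_ops = (left_mult A ^^ Suc q) ` bounded_ops \<longleftrightarrow>
    (\<exists>S. bounded_clinear S \<and> A ^^ q = A ^^ Suc q \<circ> S)"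
  unfolding funpow_left_mult
proof
  assume eq: "(\<circ>) (A ^^ q) ` bounded_ops = (\<circ>) (A ^^ Suc q) ` bounded_ops"
  have "(id :: 'a \<Rightarrow> 'a) \<in> bounded_ops"
    by (simp add: bounded_ops_def bounded_clinear_def id_def)
  then have "A ^^ q \<circ> id \<in> (\<circ>) (A ^^ Suc q) ` bounded_ops"
    using eq by blast
  then show "\<exists>S. bounded_clinear S \<and> A ^^ q = A ^^ Suc q \<circ> S"
    by (auto simp: bounded_ops_def)
next
  assume "\<exists>S. bounded_clinear S \<and> A ^^ q = A ^^ Suc q \<circ> S"
  then obtain S where S: "bounded_clinear S" "A ^^ q = A ^^ Suc q \<circ> S" by blast
  show "(\<circ>) (A ^^ q) ` bounded_ops = (\<circ>) (A ^^ Suc q) ` bounded_ops"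
  proof (intro equalityI image_subsetI)
    fix R :: "'a \<Rightarrow> 'a" assume "R \<in> bounded_ops"
    then have "S \<circ> R \<in> bounded_ops" "A \<circ> R \<in> bounded_ops"
      using S(1) A by (auto simp: bounded_ops_def intro: bounded_clinear_compose)
    moreover have "A ^^ q \<circ> R = A ^^ Suc q \<circ> (S \<circ> R)"
      by (subst S(2)) (simp add: o_assoc)
    moreover have "A ^^ Suc q \<circ> R = A ^^ q \<circ> (A \<circ> R)"
      by (simp add: funpow_Suc_right o_assoc del: funpow.simps)
    ultimately show "A ^^ q \<circ> R \<in> (\<circ>) (A ^^ Suc q) ` bounded_ops"
      "A ^^ Suc q \<circ> R \<in> (\<circ>) (A ^^ q) ` bounded_ops" by auto
  qed
qed

theorem corollary1:
  fixes T :: "'a::complex_banach \<Rightarrow> 'a"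
  assumes "bounded_clinear T"
    and "op_spectrum T = surjectivity_spectrum T
       \<or> interior (approx_point_spectrum T) = {}
       \<or> interior (point_spectrum T) = {}
       \<or> interior (ascent_spectrum T) = {}
       \<or> interior (upper_browder_spectrum T) = {}
       \<or> interior (upper_weyl_spectrum T) = {}
       \<or> non_svep_set T = {}"
  shows "descent_spectrum T = algebra_descent_spectrum T"
proof -
  have "descent (scalar_minus c T) \<noteq> \<infinity> \<longleftrightarrow>
      descent_on bounded_ops (left_mult (minus_scalar T c)) \<noteq> \<infinity>" for c
  proof -
    let ?A = "minus_scalar T c"
    have A: "bounded_clinear ?A" using assms(1) by (rule bounded_clinear_minus_scalar)
    \<comment> \<open>The equivalence holds for each \<open>q\<close> separately. The condition on
      \<open>T\<close> enters in the direction from equal ranges to a bounded factor, as injectivity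
      of \<open>?A\<close> on \<open>range (?A ^^ q)\<close>.\<close>
    have "range (?A ^^ q) = range (?A ^^ Suc q) \<longleftrightarrow>
        (\<exists>S. bounded_clinear S \<and> ?A ^^ q = ?A ^^ Suc q \<circ> S)" for q
    proof
      assume desc: "range (?A ^^ q) = range (?A ^^ Suc q)"
      show "\<exists>S. bounded_clinear S \<and> ?A ^^ q = ?A ^^ Suc q \<circ> S"
        using ex_bounded_factor[OF A desc]
          finite_descent_imp_kernel_range_trivial[OF assms desc] by metis
    next
      assume "\<exists>S. bounded_clinear S \<and> ?A ^^ q = ?A ^^ Suc q \<circ> S"
      then have "range (?A ^^ q) \<subseteq> range (?A ^^ Suc q)"
        by (metis comp_apply image_subset_iff rangeI)
      moreover have "range (?A ^^ Suc q) \<subseteq> range (?A ^^ q)"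
        unfolding funpow_Suc_right by auto
      ultimately show "range (?A ^^ q) = range (?A ^^ Suc q)" by blast
    qed
    then show ?thesis
      unfolding descent_on_finite_iff left_mult_stable_iff[OF A]
        range_funpow_scalar_minus[OF assms(1)] by simp
  qed
  then show ?thesis
    unfolding descent_spectrum_def algebra_descent_spectrum_def by blast
qed

end
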